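(* Let $G$ be a $1$-walk regular graph on $n$ vertices with adjacency matrix $A$, let $\mathcal{A}$ be its adjacency algebra, and let $I = A_0, A = A_1, A_2, \dotsc, A_d$ be an orthogonal basis of $\mathcal{A}$. For a matrix $X$ let $X'$ denote the orthogonal projection of $X$ onto $\mathcal{A}$. Put $\overline{A} = J - I - A$. Let $M$ and $N$ be non-zero positive semidefinite $n\times n$ matrices satisfying at least one of the following two conditions: (A) $M \circ A = 0$ and $N \circ \overline{A} = 0$; (B) $M \circ A \leq 0$, $N \circ \overline{A} = 0$ and $N \circ A \geq 0$. Then $$n \geq \frac{(\operatorname{tr} JM)(\operatorname{tr} JN)}{(\operatorname{tr} M)(\operatorname{tr} N)}.$$ Moreover, equality holds if and only if $M'N'$ is a scalar multiple of $J$, and either (A) holds, or (B) holds in such a way that $\langle M, A_r\rangle\langle A_r, N\rangle = 0$ for all $r \neq 0$.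
   Context: Graphs are finite, simple and undirected. Matrices are complex $n\times n$ matrices, $I$ is the identity matrix, $J$ is the all-ones matrix, $M^*$ is the conjugate transpose, and $\langle M, N\rangle = \operatorname{tr}(MN^* )$; orthogonality refers to this inner product. Positive semidefinite means Hermitian positive semidefinite. $B\circ C$ is the Schur (entrywise) product, and $B \le 0$, $B\ge 0$ are entrywise inequalities (in particular the entries of $B$ are real). A graph with adjacency matrix $A$ is $1$-walk regular if for every positive integer $k$ there are constants $a_k$ and $b_k$ such that $A^k\circ I = a_k I$ and $A^k\circ A = b_k A$. The adjacency algebra of the graph is the algebra generated by $A$, i.e. the set of all polynomials in $A$ (including the identity) with complex coefficients.
   Formalization: The equality characterization is stated only for connected G: for disconnected G it is false (e.g. G = 2K_2 with edges 12, 34, M and N the all-ones matrices on {1,3} and {1,2}: equality holds but M'N' = (I+A)/4). The inequality is proved for all G. *)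

theory Defs
  imports
    "HOL-Analysis.Analysis"
    "HOL-Library.Complex_Order"
    "HOL-Computational_Algebra.Polynomial"
begin

type_synonym 'n cmat = "complex ^ 'n ^ 'n"

subsection \<open>Complex matrices\<close>

definition mat_scale :: "complex \<Rightarrow> 'n::finite cmat \<Rightarrow> 'n cmat"
  where "mat_scale c M = (\<chi> i j. c * M $ i $ j)"

interpretation cmat: vector_space "mat_scale :: complex \<Rightarrow> 'n::finite cmat \<Rightarrow> 'n cmat"
  by unfold_locales (simp_all add: mat_scale_def vec_eq_iff algebra_simps)

text \<open>The class operation \<open>^\<close> is not the matrix power for the product \<open>**\<close>.\<close>

primrec mat_power :: "'n::finite cmat \<Rightarrow> nat \<Rightarrow> 'n cmat"
  where
    "mat_power M 0 = mat 1"
  | "mat_power M (Suc k) = M ** mat_power M k"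

definition all_ones :: "'n::finite cmat"
  where "all_ones = (\<chi> i j. 1)"

definition conj_transpose :: "'n::finite cmat \<Rightarrow> 'n cmat"
  where "conj_transpose M = (\<chi> i j. cnj (M $ j $ i))"

definition mat_inner :: "'n::finite cmat \<Rightarrow> 'n cmat \<Rightarrow> complex"
  where "mat_inner M N = trace (M ** conj_transpose N)"

definition schur :: "'n::finite cmat \<Rightarrow> 'n cmat \<Rightarrow> 'n cmat"  (infixl "\<circ>\<^sub>S" 70)
  where "M \<circ>\<^sub>S N = (\<chi> i j. M $ i $ j * N $ i $ j)"

text \<open>
  The order on \<^typ>\<open>complex\<close> is the one of \<^theory>\<open>HOL-Library.Complex_Order\<close>:
  \<open>z \<le> w\<close> means \<open>Re z \<le> Re w\<close> and \<open>Im z = Im w\<close>.  Hence \<open>0 \<le> z\<close> and \<open>z \<le> 0\<close> contain the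
  claim that \<open>z\<close> is real.  The order on matrices is the induced entrywise one.
\<close>

definition psd :: "'n::finite cmat \<Rightarrow> bool"
  where "psd M \<longleftrightarrow> conj_transpose M = M \<and>
    (\<forall>x :: complex ^ 'n. 0 \<le> (\<Sum>i\<in>UNIV. cnj (x $ i) * (M *v x) $ i))"

text \<open>Intended for (finite-dimensional) complex subspaces \<open>S\<close>, where the projection exists and is unique.\<close>

definition orth_proj :: "'n::finite cmat set \<Rightarrow> 'n cmat \<Rightarrow> 'n cmat"
  where "orth_proj S X = (THE Y. Y \<in> S \<and> (\<forall>Z\<in>S. mat_inner (X - Y) Z = 0))"

definition orthogonal_basis :: "'n::finite cmat set \<Rightarrow> (nat \<Rightarrow> 'n cmat) \<Rightarrow> nat \<Rightarrow> bool"
  where "orthogonal_basis S B d \<longleftrightarrow>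
    inj_on B {..d} \<and> cmat.independent (B ` {..d}) \<and> cmat.span (B ` {..d}) = S \<and>
    (\<forall>r\<le>d. \<forall>s\<le>d. r \<noteq> s \<longrightarrow> mat_inner (B r) (B s) = 0)"

subsection \<open>Graphs\<close>

text \<open>
  A graph on \<open>n\<close> vertices is given by its adjacency relation on a finite vertex type
  \<^typ>\<open>'n\<close> with \<open>CARD('n) = n\<close>.
\<close>

definition simple_graph :: "('n::finite \<Rightarrow> 'n \<Rightarrow> bool) \<Rightarrow> bool"
  where "simple_graph E \<longleftrightarrow> symp E \<and> irreflp E"

text \<open>
  Connectedness is needed only for the characterization of equality.  For \<open>2 K\<^sub>2\<close> with edges
  \<open>12\<close>, \<open>34\<close>, taking \<open>M\<close> and \<open>N\<close> to be the all-ones matrices on \<open>{1, 3}\<close> and \<open>{1, 2}\<close> gives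
  equality in the bound, while the product of their projections, \<open>(I + A) / 4\<close>, is not a
  multiple of \<open>J\<close>.
\<close>

definition connected_graph :: "('n::finite \<Rightarrow> 'n \<Rightarrow> bool) \<Rightarrow> bool"
  where "connected_graph E \<longleftrightarrow> (\<forall>u v. E\<^sup>*\<^sup>* u v)"

definition adjacency :: "('n::finite \<Rightarrow> 'n \<Rightarrow> bool) \<Rightarrow> 'n cmat"
  where "adjacency E = (\<chi> u v. if E u v then 1 else 0)"

definition one_walk_regular :: "('n::finite \<Rightarrow> 'n \<Rightarrow> bool) \<Rightarrow> bool"
  where "one_walk_regular E \<longleftrightarrow>
    (\<forall>k\<ge>1. \<exists>a b. mat_power (adjacency E) k \<circ>\<^sub>S mat 1 = mat_scale a (mat 1) \<and>
                 mat_power (adjacency E) k \<circ>\<^sub>S adjacency E = mat_scale b (adjacency E))"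

definition mat_poly :: "complex poly \<Rightarrow> 'n::finite cmat \<Rightarrow> 'n cmat"
  where "mat_poly p M = (\<Sum>i\<le>degree p. mat_scale (coeff p i) (mat_power M i))"

definition adjacency_algebra :: "('n::finite \<Rightarrow> 'n \<Rightarrow> bool) \<Rightarrow> 'n cmat set"
  where "adjacency_algebra E = range (\<lambda>p. mat_poly p (adjacency E))"

definition complement_adjacency :: "('n::finite \<Rightarrow> 'n \<Rightarrow> bool) \<Rightarrow> 'n cmat"
  where "complement_adjacency E = all_ones - mat 1 - adjacency E"

subsection \<open>The two conditions on a pair of matrices\<close>

definition condition_A :: "('n::finite \<Rightarrow> 'n \<Rightarrow> bool) \<Rightarrow> 'n cmat \<Rightarrow> 'n cmat \<Rightarrow> bool"
  where "condition_A E M N \<longleftrightarrow> M \<circ>\<^sub>S adjacency E = 0 \<and> N \<circ>\<^sub>S complement_adjacency E = 0"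

definition condition_B :: "('n::finite \<Rightarrow> 'n \<Rightarrow> bool) \<Rightarrow> 'n cmat \<Rightarrow> 'n cmat \<Rightarrow> bool"
  where "condition_B E M N \<longleftrightarrow>
    M \<circ>\<^sub>S adjacency E \<le> 0 \<and> N \<circ>\<^sub>S complement_adjacency E = 0 \<and> N \<circ>\<^sub>S adjacency E \<ge> 0"

end

theory Submission
  imports Defs
begin

text \<open>
  Write \<open>\<A>\<close> for the adjacency algebra and \<open>X'\<close> for the orthogonal projection of \<open>X\<close> to \<open>\<A>\<close>.
  Both conditions force \<open>N\<close> to vanish off the diagonal and the edges.  Since the graph is
  1-walk regular, every element of \<open>\<A>\<close> is constant on the diagonal and constant on the edges;
  so \<open>N\<close> is orthogonal to every element of \<open>\<A>\<close> that is orthogonal to \<open>I\<close> and \<open>A\<close>, and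
  \<open>N' = (tr N / n) I + (\<langle>N, A\<rangle> / \<langle>A, A\<rangle>) A\<close> (\<open>orth_proj_supported\<close>).  Hence
  \<open>tr (M N') = (tr M) (tr N) / n + \<langle>M, A\<rangle> \<langle>A, N\<rangle> / \<langle>A, A\<rangle>\<close>, and the last summand is not positive.

  For a lower bound on \<open>tr (M N')\<close>, observe that \<open>N'\<close> is positive semidefinite
  (\<open>psd_orth_proj\<close>) and that the all-ones vector is an eigenvector of it.  Splitting off this
  eigenvector leaves the matrix \<open>T = N' - (tr J N / n\<^sup>2) J\<close>, which is still positive
  semidefinite (\<open>psd_slack_matrix\<close>), so \<open>tr (M T) \<ge> 0\<close> (\<open>trace_psd_mult\<close>).  Together,
    \<open>(tr J M) (tr J N) = n (tr M) (tr N) - n\<^sup>2 (tr (M T) - \<langle>M, A\<rangle> \<langle>A, N\<rangle> / \<langle>A, A\<rangle>)\<close>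
  (\<open>trace_slack_identity\<close>), and the bracket is a sum of two nonnegative terms.

  Equality therefore means that both terms vanish.  The second one vanishes iff
  \<open>\<langle>M, A\<^sub>r\<rangle> \<langle>A\<^sub>r, N\<rangle> = 0\<close> for all \<open>r \<noteq> 0\<close>, because \<open>\<langle>A\<^sub>r, N\<rangle> = 0\<close> whenever \<open>r \<ge> 2\<close>;
  under (A) it vanishes since \<open>\<langle>M, A\<rangle> = 0\<close>.  As for the first, in a connected
  graph \<open>J\<close> and hence \<open>T\<close> lie in \<open>\<A>\<close>.  If \<open>tr (M T) = 0\<close>, then \<open>M T = 0\<close>
  by semidefiniteness, so \<open>M' T = (M T)' = 0\<close> and \<open>M' N'\<close> is a multiple of \<open>M' J\<close>, that is, of
  \<open>J\<close>.  Conversely, if \<open>M' N'\<close> is a multiple of \<open>J\<close>, then so is \<open>M' T\<close>, and \<open>T J = 0\<close> shows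
  that \<open>M' T = 0\<close> (\<open>trace_mult_slack_eq_0_iff\<close>).

  The argument does not diagonalize the adjacency matrix.  What it uses about the spectrum is
  that a singular element of a finite-dimensional algebra with unit annihilates a nonzero
  element of that algebra (\<open>singular_imp_right_zero_divisor\<close>).  This enters both the
  semidefiniteness of \<open>N'\<close> and, for connected graphs, the membership of \<open>J\<close> in \<open>\<A>\<close>.
\<close>

section \<open>Hermitian forms\<close>

definition herm_form :: "'n::finite cmat \<Rightarrow> complex ^ 'n \<Rightarrow> complex ^ 'n \<Rightarrow> complex"
  where "herm_form M x y = (\<Sum>i\<in>UNIV. cnj (x $ i) * (M *v y) $ i)"

lemma herm_form_entries:
  "herm_form M x y = (\<Sum>i\<in>UNIV. \<Sum>j\<in>UNIV. cnj (x $ i) * M $ i $ j * y $ j)"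
  by (simp add: herm_form_def matrix_vector_mult_def sum_distrib_left mult.assoc)

lemma herm_form_diff_right: "herm_form M x (y - z) = herm_form M x y - herm_form M x z"
  by (simp add: herm_form_def matrix_vector_mult_diff_distrib algebra_simps sum_subtractf)

lemma herm_form_diff_left: "herm_form M (x - y) z = herm_form M x z - herm_form M y z"
  by (simp add: herm_form_def algebra_simps sum_subtractf)

lemma herm_form_scale_right: "herm_form M x (c *s y) = c * herm_form M x y"
  by (simp add: herm_form_entries sum_distrib_left algebra_simps)

lemma herm_form_scale_left: "herm_form M (c *s x) y = cnj c * herm_form M x y"
  by (simp add: herm_form_def sum_distrib_left algebra_simps)

lemma herm_form_zero_right [simp]: "herm_form M x 0 = 0"
  by (simp add: herm_form_def)

lemma herm_form_diff_matrix: "herm_form (M - M') x y = herm_form M x y - herm_form M' x y"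
  by (simp add: herm_form_entries algebra_simps sum_subtractf)

lemma herm_form_scaleR:
  "herm_form M (c *\<^sub>R x) (c *\<^sub>R x) = of_real (c\<^sup>2) * herm_form M x x"
  unfolding herm_form_entries
  by (simp add: sum_distrib_left scaleR_conv_of_real[where 'a = complex] power2_eq_square mult_ac)

lemma herm_form_conj: "cnj (herm_form M x y) = herm_form (conj_transpose M) y x"
  unfolding herm_form_entries conj_transpose_def
  by (subst sum.swap) (simp add: algebra_simps)

lemma herm_form_rank_one:
  "herm_form (mat_scale c (\<chi> i j. u $ i * cnj (u $ j))) x y =
    c * (\<Sum>i\<in>UNIV. cnj (x $ i) * u $ i) * cnj (\<Sum>i\<in>UNIV. cnj (y $ i) * u $ i)"
  by (simp add: herm_form_entries mat_scale_def sum_product sum_distrib_left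
       sum_distrib_right algebra_simps)

lemma of_real_norm_vec_power2: "complex_of_real ((norm (x :: complex ^ 'n::finite))\<^sup>2) = (\<Sum>i\<in>UNIV. cnj (x $ i) * x $ i)"
proof -
  have "(norm x)\<^sup>2 = (\<Sum>i\<in>UNIV. (norm (x $ i))\<^sup>2)"
    by (simp add: norm_vec_def L2_set_def sum_nonneg)
  then show ?thesis
    by (simp only: of_real_sum complex_norm_square) (simp add: mult.commute)
qed

lemma herm_form_scalar_matrix: "herm_form (mat_scale c (mat 1)) x x = c * of_real ((norm x)\<^sup>2)"
  unfolding herm_form_entries of_real_norm_vec_power2
  by (simp add: mat_scale_def mat_def sum_distrib_left if_distrib if_distribR mult_ac cong: if_cong)

lemma shifted_matrix_mult_vec: "(S - mat_scale c (mat 1)) *v v = S *v v - c *s v"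
  by (simp add: vec_eq_iff matrix_vector_mult_diff_rdistrib)
    (simp add: matrix_vector_mult_def mat_scale_def mat_def if_distrib if_distribR cong: if_cong)

lemma matrix_vector_mult_axis:
  fixes T :: "'n::finite cmat"
  shows "(T *v axis i 1) $ j = T $ j $ i"
  by (simp add: matrix_vector_mult_def axis_def mult.commute[of _ "if _ then _ else _"] if_distrib if_distribR cong: if_cong)

lemma sum_cnj_axis: "(\<Sum>j\<in>UNIV. cnj (axis i 1 $ j) * y j) = y (i::'n::finite)"
  by (simp add: axis_def if_distrib if_distribR cong: if_cong)

section \<open>Positive semidefinite matrices\<close>

lemma psd_iff_herm_form: "psd M \<longleftrightarrow> conj_transpose M = M \<and> (\<forall>x. 0 \<le> herm_form M x x)"
  by (simp add: psd_def herm_form_def)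

text \<open>
  The form is nonnegative at \<open>e - a (T e)\<close> for every real \<open>a\<close>, and its part that is linear in
  \<open>a\<close> is \<open>- 2 a \<parallel>T e\<parallel>\<^sup>2\<close>; for small positive \<open>a\<close> this part dominates unless \<open>T e = 0\<close>.
\<close>

lemma psd_kernel:
  assumes "psd T" "herm_form T e e = 0"
  shows "T *v e = 0"
proof -
  define y where "y = T *v e"
  define s where "s = (norm y)\<^sup>2"
  define K where "K = Re (herm_form T y y)"
  have hT: "conj_transpose T = T" and pT: "\<And>x. 0 \<le> herm_form T x x"
    using assms by (auto simp: psd_iff_herm_form)
  have ye: "herm_form T y e = of_real s"
    unfolding s_def of_real_norm_vec_power2 by (simp add: herm_form_def y_def)
  have ey: "herm_form T e y = of_real s"
    using herm_form_conj[of T y e] hT ye by simp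
  have K: "herm_form T y y = of_real K" "0 \<le> K"
    using pT[of y] by (auto simp: K_def less_eq_complex_def complex_eq_iff)
  \<comment> \<open>With this step the quadratic part \<open>a\<^sup>2 K\<close> is at most \<open>a s\<close>; the summand 1 keeps the denominator positive.\<close>
  define a where "a = s / (K + 1)"
  have "herm_form T (e - of_real a *s y) (e - of_real a *s y) = of_real (- 2 * a * s + a\<^sup>2 * K)"
    by (simp add: herm_form_diff_left herm_form_diff_right herm_form_scale_left
        herm_form_scale_right ye ey K(1) assms power2_eq_square algebra_simps)
  then have "0 \<le> - 2 * a * s + a\<^sup>2 * K"
    using pT[of "e - of_real a *s y"] by (simp add: less_eq_complex_def)
  also have "\<dots> = - (s / (K+1))\<^sup>2 * (K + 2)"
  proof -
    have "s = a * (K + 1)" using K(2) by (simp add: a_def)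
    then show ?thesis unfolding a_def[symmetric] by (simp add: power2_eq_square algebra_simps)
  qed
  finally have "s / (K+1) = 0"
    using K(2) by (smt (verit) mult_minus_left mult_pos_pos zero_less_power2)
  then show ?thesis using K(2) by (simp add: s_def y_def)
qed

lemma psd_diag_zero:
  assumes "psd T" "T $ i $ i = 0"
  shows "T $ j $ i = 0"
proof -
  have "herm_form T (axis i 1) (axis i 1) = 0"
    using assms(2)
    by (simp add: herm_form_def sum_cnj_axis matrix_vector_mult_axis)
  from psd_kernel[OF assms(1) this] have "(T *v axis i 1) $ j = 0" by simp
  then show ?thesis by (simp add: matrix_vector_mult_axis)
qed

text \<open>
  The Schur complement of \<open>T\<close> in direction \<open>e\<close>.  If \<open>\<langle>e, T e\<rangle> = 0\<close>, the inverse is \<open>0\<close> and the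
  matrix stays as it is.
\<close>

definition deflate :: "'n::finite cmat \<Rightarrow> complex ^ 'n \<Rightarrow> 'n cmat"
  where "deflate T e = T - mat_scale (inverse (herm_form T e e)) (\<chi> i j. (T *v e) $ i * cnj ((T *v e) $ j))"

text \<open>
  Completing the square: the form of the deflated matrix at \<open>x\<close> is the form of \<open>T\<close> at the
  vector \<open>x - c e\<close> with the smallest value among all \<open>c\<close>.
\<close>

lemma psd_deflate:
  assumes "psd T"
  shows "psd (deflate T e)"
proof -
  define t where "t = herm_form T e e"
  have hT: "conj_transpose T = T" and pT: "\<And>x. 0 \<le> herm_form T x x"
    using assms by (auto simp: psd_iff_herm_form)
  have tr: "cnj t = t" using herm_form_conj[of T e e] hT by (simp add: t_def)
  have herm: "conj_transpose (deflate T e) = deflate T e"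
    using hT tr by (simp add: deflate_def conj_transpose_def mat_scale_def vec_eq_iff t_def mult.commute)
  have "0 \<le> herm_form (deflate T e) x x" for x
  proof (cases "t = 0")
    case True
    then show ?thesis using pT by (simp add: deflate_def t_def mat_scale_def herm_form_diff_matrix)
      (simp add: herm_form_entries)
  next
    case False
    define c where "c = herm_form T e x / t"
    have xe: "herm_form T x e = cnj (c * t)"
      using herm_form_conj[of T e x] hT False by (simp add: c_def)
    have "herm_form (deflate T e) x x = herm_form T x x - inverse t * herm_form T x e * cnj (herm_form T x e)"
      unfolding deflate_def herm_form_diff_matrix herm_form_rank_one
      by (simp add: herm_form_def t_def)
    also have "\<dots> = herm_form T (x - c *s e) (x - c *s e)"
      using False
      by (simp add: herm_form_diff_left herm_form_diff_right herm_form_scale_left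
        herm_form_scale_right xe t_def[symmetric] tr) (simp add: c_def)
    finally show ?thesis using pT by simp
  qed
  then show ?thesis by (simp add: psd_iff_herm_form herm)
qed

text \<open>
  Cholesky factorization as an induction: deflating \<open>T\<close> along a coordinate axis \<open>i\<close> with
  \<open>T $ i $ i \<noteq> 0\<close> clears the \<open>i\<close>-th diagonal entry and splits off a rank-one matrix with column
  \<open>u = T e\<^sub>i\<close>, which contributes \<open>\<langle>u, M u\<rangle> / T $ i $ i \<ge> 0\<close> to the trace.  The trace vanishes only if
  all contributions do, and \<open>\<langle>u, M u\<rangle> = 0\<close> implies \<open>M u = 0\<close>.
\<close>

lemma trace_psd_mult:
  fixes M T :: "'n::finite cmat"
  assumes "psd M" "psd T"
  shows "0 \<le> trace (M ** T)" and "trace (M ** T) = 0 \<Longrightarrow> M ** T = 0"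
proof -
  have "0 \<le> trace (M ** T) \<and> (trace (M ** T) = 0 \<longrightarrow> M ** T = 0)"
    using \<open>psd T\<close>
  proof (induction "card {i. T $ i $ i \<noteq> 0}" arbitrary: T rule: less_induct)
    case less
    show ?case
    proof (cases "\<exists>i. T $ i $ i \<noteq> 0")
      case False
      then have "T = 0" using psd_diag_zero[OF less.prems] by (simp add: vec_eq_iff)
      then show ?thesis by (simp add: trace_def matrix_matrix_mult_def vec_eq_iff)
    next
      case True
      then obtain i where i: "T $ i $ i \<noteq> 0" by blast
      define e :: "complex ^ 'n" where "e = axis i 1"
      define u where "u = T *v e"
      define D where "D = deflate T e"
      have u: "u $ j = T $ j $ i" for j
        by (simp add: u_def e_def matrix_vector_mult_axis)
      have t: "herm_form T e e = T $ i $ i"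
        unfolding herm_form_def u_def[symmetric] u by (simp add: e_def sum_cnj_axis)
      have hT: "T $ j $ k = cnj (T $ k $ j)" for j k
        using less.prems by (simp add: psd_def conj_transpose_def vec_eq_iff)
      have tpos: "0 \<le> T $ i $ i"
        using less.prems t by (metis psd_iff_herm_form)
      have D: "D $ j $ k = T $ j $ k - u $ j * cnj (u $ k) / T $ i $ i" for j k
        by (simp add: D_def deflate_def t u_def[symmetric] mat_scale_def field_simps)
      have psdD: "psd D" using psd_deflate[OF less.prems] by (simp add: D_def)
      have "D $ i $ i = 0" using i hT[of i i] by (simp add: D u)
      moreover have "T $ j $ j = 0 \<Longrightarrow> D $ j $ j = 0" for j
        using psd_diag_zero[OF less.prems, of j i] hT[of i j] by (simp add: D u)
      ultimately have "{j. D $ j $ j \<noteq> 0} \<subset> {j. T $ j $ j \<noteq> 0}" using i by auto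
      then have "card {j. D $ j $ j \<noteq> 0} < card {j. T $ j $ j \<noteq> 0}"
        by (intro psubset_card_mono) auto
      from less.hyps[OF this psdD] have IH: "0 \<le> trace (M ** D)" "trace (M ** D) = 0 \<Longrightarrow> M ** D = 0"
        by auto
      have MT: "(M ** T) $ j $ k = (M ** D) $ j $ k + (M *v u) $ j * cnj (u $ k) / T $ i $ i" for j k
        by (simp add: matrix_matrix_mult_def D matrix_vector_mult_def right_diff_distrib
            sum_subtractf sum_distrib_right sum_divide_distrib mult.assoc)
      have tr: "trace (M ** T) = trace (M ** D) + herm_form M u u / T $ i $ i"
        by (simp add: trace_def MT sum.distrib herm_form_def sum_divide_distrib mult.commute)
      have "0 \<le> herm_form M u u" using assms(1) by (simp add: psd_iff_herm_form)
      then have q: "0 \<le> herm_form M u u / T $ i $ i"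
        using tpos by (auto simp: less_eq_complex_def Re_divide Im_divide)
      have "M ** T = 0" if z: "trace (M ** T) = 0"
      proof -
        have "trace (M ** D) = 0" "herm_form M u u / T $ i $ i = 0"
          using IH(1) q z unfolding tr by (auto simp: less_eq_complex_def complex_eq_iff)
        then have "M ** D = 0" "M *v u = 0"
          using IH(2) psd_kernel[OF assms(1)] i by auto
        then show ?thesis by (simp add: vec_eq_iff MT)
      qed
      then show ?thesis using IH(1) q by (simp add: tr)
    qed
  qed
  then show "0 \<le> trace (M ** T)" and "trace (M ** T) = 0 \<Longrightarrow> M ** T = 0" by auto
qed

text \<open>
  Rayleigh's principle: at a minimizer \<open>v\<close> of the form on the unit sphere, with minimum \<open>l\<close>,
  the matrix \<open>S - l I\<close> is positive semidefinite with isotropic vector \<open>v\<close>, so \<open>v\<close> lies in its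
  kernel.
\<close>

lemma hermitian_negative_eigenvalue:
  fixes S :: "'n::finite cmat"
  assumes hS: "conj_transpose S = S" and "\<not> psd S"
  obtains l :: real and v where "l < 0" "v \<noteq> 0" "S *v v = of_real l *s v"
proof -
  have real: "herm_form S x x = of_real (Re (herm_form S x x))" for x
    using herm_form_conj[of S x x] hS by (simp add: complex_eq_iff)
  define f where "f x = Re (herm_form S x x)" for x
  obtain x0 where x0: "f x0 < 0"
    using assms real by (auto simp: psd_iff_herm_form f_def less_eq_complex_def not_le)
      (metis Im_complex_of_real linorder_not_le)
  then have "x0 \<noteq> 0" by (auto simp: f_def)
  then have "x0 /\<^sub>R norm x0 \<in> sphere 0 1" by simp
  then have ne: "sphere 0 1 \<noteq> ({} :: (complex ^ 'n) set)" by blast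
  have "continuous_on (sphere 0 1) f"
    unfolding f_def herm_form_entries by (intro continuous_intros)
  then obtain v where v: "norm v = 1" "\<And>y. norm y = 1 \<Longrightarrow> f v \<le> f y"
    using continuous_attains_inf[OF compact_sphere ne, of f] by (auto simp: dist_norm)
  define l where "l = f v"
  \<comment> \<open>By homogeneity the bound on the unit sphere holds everywhere.\<close>
  have low: "l * (norm x)\<^sup>2 \<le> f x" for x
  proof (cases "x = 0")
    case False
    have "l \<le> f (x /\<^sub>R norm x)" using v(2)[of "x /\<^sub>R norm x"] False by (simp add: l_def)
    also have "\<dots> = f x / (norm x)\<^sup>2"
      unfolding f_def herm_form_scaleR using False
      by (simp add: field_simps power2_eq_square)
    finally show ?thesis using False by (simp add: field_simps)
  qed (simp add: f_def)
  define T where "T = S - mat_scale (of_real l) (mat 1)"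
  have T: "herm_form T x x = of_real (f x - l * (norm x)\<^sup>2)" for x
    unfolding T_def herm_form_diff_matrix herm_form_scalar_matrix f_def using real[of x] by simp
  have "conj_transpose T = T"
    using hS by (simp add: T_def conj_transpose_def mat_scale_def mat_def vec_eq_iff)
  then have "psd T"
    unfolding psd_iff_herm_form using low by (simp add: T less_eq_complex_def)
  moreover have "herm_form T v v = 0" using v(1) by (simp add: T l_def)
  ultimately have "T *v v = 0" by (rule psd_kernel)
  then have "S *v v = of_real l *s v"
    by (simp add: T_def shifted_matrix_mult_vec)
  moreover have "l < 0"
    using low[of x0] x0 by (smt (verit) mult_nonneg_nonneg zero_le_power2)
  moreover have "v \<noteq> 0" using v(1) by auto
  ultimately show thesis using that by blast
qed

section \<open>The trace inner product and orthogonal projections\<close>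

lemma trace_mult_entries: "trace (M ** T) = (\<Sum>i\<in>UNIV. \<Sum>j\<in>UNIV. M $ i $ j * T $ j $ i)"
  by (simp add: trace_def matrix_matrix_mult_def)

lemma trace_add: "trace (X + Y) = trace X + trace (Y :: 'n::finite cmat)"
  by (simp add: trace_def sum.distrib)

lemma trace_scale: "trace (mat_scale c X) = c * trace X"
  by (simp add: trace_def mat_scale_def sum_distrib_left)

lemma trace_one: "trace (mat 1 :: 'n::finite cmat) = of_nat CARD('n)"
  by (simp add: trace_def mat_def)

lemma matrix_add_rdistrib:
  fixes X Y Z :: "'n::finite cmat"
  shows "(X + Y) ** Z = X ** Z + Y ** Z"
  by (simp add: matrix_matrix_mult_def vec_eq_iff distrib_right sum.distrib)

lemma matrix_diff_rdistrib:
  fixes X Y Z :: "'n::finite cmat"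
  shows "(X - Y) ** Z = X ** Z - Y ** Z"
  by (simp add: matrix_matrix_mult_def vec_eq_iff left_diff_distrib sum_subtractf)

lemma matrix_diff_ldistrib:
  fixes X Y Z :: "'n::finite cmat"
  shows "Z ** (X - Y) = Z ** X - Z ** Y"
  by (simp add: matrix_matrix_mult_def vec_eq_iff right_diff_distrib sum_subtractf)

lemma matrix_mult_0_left: "(0 :: 'n::finite cmat) ** Y = 0"
  by (simp add: matrix_matrix_mult_def vec_eq_iff)

lemma matrix_mult_0_right: "Y ** (0 :: 'n::finite cmat) = 0"
  by (simp add: matrix_matrix_mult_def vec_eq_iff)

lemma mat_scale_mult_left: "mat_scale c X ** Y = mat_scale c (X ** Y)"
  by (simp add: mat_scale_def matrix_matrix_mult_def vec_eq_iff sum_distrib_left mult.assoc)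

lemma mat_scale_mult_right: "X ** mat_scale c Y = mat_scale c (X ** Y)"
  by (simp add: mat_scale_def matrix_matrix_mult_def vec_eq_iff sum_distrib_left mult_ac)

lemma scaleR_mat_scale: "c *\<^sub>R X = mat_scale (of_real c) X"
  by (simp add: mat_scale_def vec_eq_iff scaleR_conv_of_real[where 'a = complex])

lemma conj_transpose_conj_transpose [simp]: "conj_transpose (conj_transpose X) = X"
  by (simp add: conj_transpose_def vec_eq_iff)

lemma conj_transpose_add: "conj_transpose (X + Y) = conj_transpose X + conj_transpose Y"
  by (simp add: conj_transpose_def vec_eq_iff)

lemma conj_transpose_scale: "conj_transpose (mat_scale c X) = mat_scale (cnj c) (conj_transpose X)"
  by (simp add: conj_transpose_def mat_scale_def vec_eq_iff)

lemma conj_transpose_mult: "conj_transpose (X ** Y) = conj_transpose Y ** conj_transpose X"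
  by (simp add: conj_transpose_def matrix_matrix_mult_def vec_eq_iff mult.commute)

lemma conj_transpose_all_ones: "conj_transpose all_ones = all_ones"
  by (simp add: conj_transpose_def all_ones_def)

lemma mat_inner_entries: "mat_inner X Y = (\<Sum>i\<in>UNIV. \<Sum>j\<in>UNIV. X $ i $ j * cnj (Y $ i $ j))"
  by (simp add: mat_inner_def trace_mult_entries conj_transpose_def)

lemma mat_inner_hermitian: "conj_transpose Y = Y \<Longrightarrow> mat_inner X Y = trace (X ** Y)"
  by (simp add: mat_inner_def)

lemma mat_inner_commute: "mat_inner Y X = cnj (mat_inner X Y)"
  by (simp add: mat_inner_entries mult.commute)

lemma mat_inner_conj_transpose: "mat_inner (conj_transpose X) Y = cnj (mat_inner X (conj_transpose Y))"
  unfolding mat_inner_entries conj_transpose_def by (subst sum.swap) simp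

lemma mat_inner_add_left: "mat_inner (X + Y) Z = mat_inner X Z + mat_inner Y Z"
  by (simp add: mat_inner_entries distrib_right sum.distrib)

lemma mat_inner_diff_left: "mat_inner (X - Y) Z = mat_inner X Z - mat_inner Y Z"
  by (simp add: mat_inner_entries left_diff_distrib sum_subtractf)

lemma mat_inner_scale_left: "mat_inner (mat_scale c X) Y = c * mat_inner X Y"
  by (simp add: mat_inner_entries mat_scale_def sum_distrib_left mult_ac)

lemma mat_inner_scale_right: "mat_inner X (mat_scale c Y) = cnj c * mat_inner X Y"
  by (simp add: mat_inner_entries mat_scale_def sum_distrib_left mult_ac)

lemma mat_inner_mult_left: "mat_inner (X ** Y) Z = mat_inner X (Z ** conj_transpose Y)"
  by (simp add: mat_inner_def conj_transpose_mult matrix_mul_assoc)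

lemma mat_inner_one: "mat_inner X (mat 1) = trace X"
  by (simp add: mat_inner_entries trace_def mat_def if_distrib if_distribR cong: if_cong)

lemma Re_mat_inner: "Re (mat_inner X Y) = X \<bullet> Y"
  by (simp add: mat_inner_entries inner_vec_def inner_complex_def)

lemma mat_inner_self: "mat_inner X X = of_real ((norm X)\<^sup>2)"
proof -
  have "Im (mat_inner X X) = 0" by (simp add: mat_inner_entries)
  then show ?thesis using Re_mat_inner[of X X] by (simp add: complex_eq_iff power2_norm_eq_inner)
qed

lemma trace_all_ones_mult: "trace (all_ones ** X) = mat_inner X all_ones"
  unfolding mat_inner_hermitian[OF conj_transpose_all_ones] by (rule trace_mul_sym)

lemma trace_all_ones_mult_form: "trace (all_ones ** X) = herm_form X 1 1"
  unfolding trace_all_ones_mult by (simp add: mat_inner_entries herm_form_entries all_ones_def)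

text \<open>
  Real orthogonality, as provided by the Euclidean structure, controls only the real part of
  \<^const>\<open>mat_inner\<close>.  Testing against \<open>\<i> Z\<close> as well as \<open>Z\<close> gives complex orthogonality.
\<close>

lemma orthogonal_decomposition:
  assumes S: "cmat.subspace S"
  obtains Y where "Y \<in> S" "\<And>Z. Z \<in> S \<Longrightarrow> mat_inner (X - Y) Z = 0"
proof -
  have "subspace S"
    using S by (auto simp: subspace_def cmat.subspace_def scaleR_mat_scale)
  then have span: "span S = S" by (rule span_eq_iff[THEN iffD2])
  obtain Y W where YW: "Y \<in> S" "\<And>Z. Z \<in> S \<Longrightarrow> W \<bullet> Z = 0" "X = Y + W"
    using orthogonal_subspace_decomp_exists[of S X] span by (metis orthogonal_def)
  have "mat_inner W Z = 0" if Z: "Z \<in> S" for Z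
  proof -
    have "Re (mat_inner W Z) = 0" using YW Z by (simp add: Re_mat_inner)
    moreover have "Re (mat_inner W (mat_scale \<i> Z)) = 0"
      using YW Z S unfolding Re_mat_inner by (simp add: cmat.subspace_scale)
    ultimately show ?thesis by (simp add: mat_inner_scale_right complex_eq_iff)
  qed
  then show thesis using that[of Y] YW by simp
qed

lemma orth_proj_eqI:
  assumes S: "cmat.subspace S" and Y: "Y \<in> S" "\<And>Z. Z \<in> S \<Longrightarrow> mat_inner (X - Y) Z = 0"
  shows "orth_proj S X = Y"
  unfolding orth_proj_def
proof (rule the_equality)
  fix Y' assume Y': "Y' \<in> S \<and> (\<forall>Z\<in>S. mat_inner (X - Y') Z = 0)"
  then have "Y - Y' \<in> S" using S Y by (simp add: cmat.subspace_diff)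
  then have "mat_inner (X - Y') (Y - Y') - mat_inner (X - Y) (Y - Y') = 0" using Y' Y by simp
  then have "mat_inner (Y - Y') (Y - Y') = 0"
    by (simp add: mat_inner_diff_left)
  then show "Y' = Y" by (simp add: mat_inner_self)
qed (use Y in blast)

lemma orth_proj:
  assumes "cmat.subspace S"
  shows "orth_proj S X \<in> S" and "Z \<in> S \<Longrightarrow> mat_inner (orth_proj S X) Z = mat_inner X Z"
proof -
  obtain Y where Y: "Y \<in> S" "\<And>Z. Z \<in> S \<Longrightarrow> mat_inner (X - Y) Z = 0"
    using orthogonal_decomposition[OF assms] by blast
  have "orth_proj S X = Y" by (rule orth_proj_eqI) (use assms Y in auto)
  then show "orth_proj S X \<in> S" "Z \<in> S \<Longrightarrow> mat_inner (orth_proj S X) Z = mat_inner X Z"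
    using Y by (auto simp: mat_inner_diff_left)
qed

lemma psd_mult_conj_transpose: "psd (Z ** conj_transpose Z)"
proof -
  have "herm_form (Z ** conj_transpose Z) x x = of_real ((norm (conj_transpose Z *v x))\<^sup>2)" for x
  proof -
    have "herm_form (Z ** conj_transpose Z) x x =
        (\<Sum>i\<in>UNIV. \<Sum>k\<in>UNIV. cnj (x $ i) * Z $ i $ k * (conj_transpose Z *v x) $ k)"
      unfolding herm_form_def matrix_vector_mul_assoc[symmetric]
      by (subst matrix_vector_mult_def) (simp add: sum_distrib_left mult.assoc)
    also have "\<dots> = of_real ((norm (conj_transpose Z *v x))\<^sup>2)"
      unfolding of_real_norm_vec_power2
    proof (subst sum.swap, intro sum.cong refl)
      fix k
      have "cnj ((conj_transpose Z *v x) $ k) = (\<Sum>i\<in>UNIV. cnj (x $ i) * Z $ i $ k)"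
        by (simp add: matrix_vector_mult_def conj_transpose_def mult.commute)
      then show "(\<Sum>i\<in>UNIV. cnj (x $ i) * Z $ i $ k * (conj_transpose Z *v x) $ k) =
          cnj ((conj_transpose Z *v x) $ k) * (conj_transpose Z *v x) $ k"
        by (simp add: sum_distrib_right)
    qed
    finally show ?thesis .
  qed
  then show ?thesis by (simp add: psd_iff_herm_form conj_transpose_mult less_eq_complex_def)
qed

lemma psd_trace_pos:
  assumes "psd M" "M \<noteq> 0"
  shows "0 < trace M"
proof -
  have "conj_transpose (mat 1 :: 'a cmat) = mat 1"
    by (simp add: conj_transpose_def mat_def vec_eq_iff)
  then have "psd (mat 1 :: 'a cmat)"
    using psd_mult_conj_transpose[of "mat 1 :: 'a cmat"] by simp
  from trace_psd_mult[OF assms(1) this] have "0 \<le> trace M" "trace M = 0 \<Longrightarrow> M = 0" by simp_all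
  then show ?thesis using assms(2) by (auto simp: order_less_le)
qed

section \<open>Matrix algebras closed under conjugate transposition\<close>

locale matrix_star_algebra =
  fixes \<A> :: "'n::finite cmat set"
  assumes subspace: "cmat.subspace \<A>"
    and one_closed: "mat 1 \<in> \<A>"
    and mult_closed: "X \<in> \<A> \<Longrightarrow> Y \<in> \<A> \<Longrightarrow> X ** Y \<in> \<A>"
    and conj_transpose_closed: "X \<in> \<A> \<Longrightarrow> conj_transpose X \<in> \<A>"
begin

text \<open>
  Left multiplication by \<open>S\<close> is a linear endomorphism of the finite-dimensional space \<open>\<A>\<close>.  Were
  it injective, it would be onto and \<open>S\<close> would have a right inverse in \<open>\<A>\<close>, contradicting
  \<open>S v = 0\<close>.
\<close>

lemma singular_imp_right_zero_divisor:
  assumes S: "S \<in> \<A>" and v: "v \<noteq> 0" "S *v v = 0"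
  obtains Z where "Z \<in> \<A>" "Z \<noteq> 0" "S ** Z = 0"
proof -
  have sub: "Real_Vector_Spaces.subspace \<A>"
    using subspace by (auto simp: Real_Vector_Spaces.subspace_def cmat.subspace_def scaleR_mat_scale)
  have lin: "linear ((**) S :: 'n cmat \<Rightarrow> 'n cmat)"
    by (rule linearI) (simp_all only: matrix_add_ldistrib scaleR_mat_scale mat_scale_mult_right)
  have "\<not> inj_on ((**) S) \<A>"
  proof
    assume inj: "inj_on ((**) S) \<A>"
    have "dim ((**) S ` \<A>) = dim \<A>"
      using dim_image_eq[OF lin, of \<A>] inj sub by (simp add: span_eq_iff[THEN iffD2])
    moreover have "(**) S ` \<A> \<subseteq> \<A>" using S mult_closed by blast
    ultimately have "(**) S ` \<A> = \<A>"
      using subspace_dim_equal linear_subspace_image[OF lin sub] sub by (metis order_refl)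
    then obtain R where "S ** R = mat 1" using one_closed by (metis imageE)
    then have "R ** S = mat 1" by (rule matrix_left_right_inverse1)
    then have "v = R *v (S *v v)" by (simp add: matrix_vector_mul_assoc)
    then show False using v by simp
  qed
  then show thesis
    using that unfolding linear_inj_on_iff_eq_0[OF lin sub] by blast
qed

text \<open>
  A negative eigenvalue \<open>l\<close> of \<open>S\<close> on vectors is also an eigenvalue of left multiplication by
  \<open>S\<close> on \<open>\<A>\<close>: there is \<open>Z \<noteq> 0\<close> in \<open>\<A>\<close> with \<open>S Z = l Z\<close>.  Then
  \<open>\<langle>S, Z Z\<^sup>*\<rangle> = l \<parallel>Z\<parallel>\<^sup>2 < 0\<close>.  So positivity needs testing only against the squares in \<open>\<A>\<close>.
\<close>

lemma psd_if_pairing_nonneg: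
  assumes S: "S \<in> \<A>" "conj_transpose S = S"
    and pos: "\<And>Z. Z \<in> \<A> \<Longrightarrow> 0 \<le> mat_inner S (Z ** conj_transpose Z)"
  shows "psd S"
proof (rule ccontr)
  assume "\<not> psd S"
  then obtain l v where l: "l < 0" "v \<noteq> 0" "S *v v = of_real l *s v"
    using hermitian_negative_eigenvalue S(2) by blast
  define T where "T = S - mat_scale (of_real l) (mat 1)"
  have "T \<in> \<A>"
    unfolding T_def by (intro cmat.subspace_diff cmat.subspace_scale subspace S one_closed)
  moreover have "T *v v = 0"
    using l by (simp add: T_def shifted_matrix_mult_vec)
  ultimately obtain Z where Z: "Z \<in> \<A>" "Z \<noteq> 0" "T ** Z = 0"
    using singular_imp_right_zero_divisor l(2) by blast
  have "S ** Z = mat_scale (of_real l) Z"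
    using Z(3) by (simp add: T_def matrix_diff_rdistrib mat_scale_mult_left)
  then have "mat_inner S (Z ** conj_transpose Z) = of_real (l * (norm Z)\<^sup>2)"
    using mat_inner_mult_left[of S Z Z] by (simp add: mat_inner_scale_left mat_inner_self)
  then show False
    using pos[OF Z(1)] l(1) Z(2) by (simp add: less_eq_complex_def zero_le_mult_iff)
qed

text \<open>
  The projection has the same inner products with the squares \<open>Z Z\<^sup>*\<close> of \<open>\<A>\<close> as \<open>X\<close> has, and it is
  Hermitian because \<open>\<A>\<close> is closed under conjugate transposition.
\<close>

lemma psd_orth_proj:
  assumes X: "psd X"
  shows "psd (orth_proj \<A> X)"
proof (rule psd_if_pairing_nonneg)
  let ?Y = "orth_proj \<A> X"
  note Y = orth_proj[OF subspace]
  have hX: "conj_transpose X = X" using X by (simp add: psd_def)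
  \<comment> \<open>The Hermitian defect \<open>D\<close> of the projection is orthogonal to itself.\<close>
  define D where "D = conj_transpose ?Y - ?Y"
  have D: "D \<in> \<A>" unfolding D_def by (intro cmat.subspace_diff subspace conj_transpose_closed Y)
  have "mat_inner (conj_transpose ?Y) D = cnj (mat_inner X (conj_transpose D))"
    using D by (simp add: mat_inner_conj_transpose Y conj_transpose_closed)
  also have "\<dots> = mat_inner ?Y D"
    using D mat_inner_conj_transpose[of X D] hX by (simp add: Y)
  finally have "mat_inner D D = 0"
    unfolding D_def by (simp add: mat_inner_diff_left)
  then show "conj_transpose ?Y = ?Y" by (simp add: mat_inner_self D_def)
  show "?Y \<in> \<A>" by (rule Y)
  fix Z assume Z: "Z \<in> \<A>"
  then have "mat_inner ?Y (Z ** conj_transpose Z) = mat_inner X (Z ** conj_transpose Z)"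
    by (intro Y mult_closed conj_transpose_closed)
  also have "\<dots> = trace (X ** (Z ** conj_transpose Z))"
    by (simp add: mat_inner_hermitian conj_transpose_mult)
  finally have "mat_inner ?Y (Z ** conj_transpose Z) = trace (X ** (Z ** conj_transpose Z))" .
  then show "0 \<le> mat_inner ?Y (Z ** conj_transpose Z)"
    using trace_psd_mult(1)[OF X psd_mult_conj_transpose] by simp
qed

text \<open>
  The module property of a conditional expectation: moving \<open>T\<close> to the other side of the inner
  product turns \<open>Z\<close> into \<open>Z T\<^sup>*\<close>, which stays in \<open>\<A>\<close>.
\<close>

lemma orth_proj_mult_right:
  assumes "T \<in> \<A>"
  shows "orth_proj \<A> (X ** T) = orth_proj \<A> X ** T"
proof (rule orth_proj_eqI)
  note Y = orth_proj[OF subspace]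
  fix Z assume "Z \<in> \<A>"
  then show "mat_inner (X ** T - orth_proj \<A> X ** T) Z = 0"
    using assms by (simp add: mat_inner_diff_left mat_inner_mult_left Y mult_closed conj_transpose_closed)
qed (use assms orth_proj[OF subspace] mult_closed subspace in auto)

end

section \<open>The adjacency algebra\<close>

lemma mat_poly_upto:
  assumes "degree p \<le> m"
  shows "mat_poly p M = (\<Sum>i\<le>m. mat_scale (coeff p i) (mat_power M i))"
  unfolding mat_poly_def
  by (rule sum.mono_neutral_left) (use assms in \<open>auto simp: coeff_eq_0 not_le\<close>)

text \<open>
  Linear properties of the algebra can thus be checked on the powers of the adjacency matrix.
\<close>

lemma adjacency_algebra_span: "adjacency_algebra E = cmat.span (range (mat_power (adjacency E)))"
proof
  let ?A = "adjacency E"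
  show "adjacency_algebra E \<subseteq> cmat.span (range (mat_power ?A))"
    unfolding adjacency_algebra_def mat_poly_def
    by (intro image_subsetI cmat.span_sum cmat.span_scale cmat.span_base rangeI)
  show "cmat.span (range (mat_power ?A)) \<subseteq> adjacency_algebra E"
  proof (rule cmat.span_minimal)
    have "mat_power ?A k = mat_poly (monom 1 k) ?A" for k
      by (simp add: mat_poly_def degree_monom_eq) (simp add: if_distrib if_distribR cong: if_cong)
    then show "range (mat_power ?A) \<subseteq> adjacency_algebra E"
      unfolding adjacency_algebra_def by auto
    have add: "mat_poly p ?A + mat_poly q ?A = mat_poly (p + q) ?A" for p q
    proof -
      define m where "m = max (degree p) (degree q)"
      have "degree (p + q) \<le> m" unfolding m_def by (rule degree_add_le_max)
      then show ?thesis
        by (simp add: mat_poly_upto[of _ m] m_def sum.distrib[symmetric] cmat.scale_left_distrib)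
    qed
    have scale: "mat_scale c (mat_poly p ?A) = mat_poly (smult c p) ?A" for c p
      by (simp add: mat_poly_upto[of _ "degree p"] degree_smult_le cmat.scale_sum_right)
    have zero: "0 = mat_poly 0 ?A"
      by (simp add: mat_poly_def)
    show "cmat.subspace (adjacency_algebra E)"
      unfolding adjacency_algebra_def
    proof (rule cmat.subspaceI)
      show "0 \<in> range (\<lambda>p. mat_poly p ?A)" using zero by (rule range_eqI)
    qed (auto simp: add scale)
  qed
qed

lemma mat_power_in_adjacency_algebra: "mat_power (adjacency E) k \<in> adjacency_algebra E"
  unfolding adjacency_algebra_span by (intro cmat.span_base rangeI)

lemma adjacency_in_adjacency_algebra: "adjacency E \<in> adjacency_algebra E"
  using mat_power_in_adjacency_algebra[of E 1] by simp

lemma adjacency_algebra_induct [consumes 1, case_names zero add scale power]: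
  assumes Z: "Z \<in> adjacency_algebra E"
    and zero: "P 0" and add: "\<And>X Y. P X \<Longrightarrow> P Y \<Longrightarrow> P (X + Y)"
    and scale: "\<And>c X. P X \<Longrightarrow> P (mat_scale c X)"
    and power: "\<And>k. P (mat_power (adjacency E) k)"
  shows "P Z"
proof -
  have "cmat.span (range (mat_power (adjacency E))) \<subseteq> Collect P"
  proof (rule cmat.span_minimal)
    show "range (mat_power (adjacency E)) \<subseteq> Collect P" using power by blast
    show "cmat.subspace (Collect P)"
      by (rule cmat.subspaceI) (use zero add scale in blast)+
  qed
  then show ?thesis using Z unfolding adjacency_algebra_span by blast
qed

lemma mat_power_add: "mat_power M (i + j) = mat_power M i ** mat_power M j"
  by (induction i) (simp_all add: matrix_mul_assoc)

lemma mat_power_commute: "mat_power M k ** M = M ** mat_power M k"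
  using mat_power_add[of M k 1] by simp

lemma adjacency_entry_commute: "simple_graph E \<Longrightarrow> adjacency E $ i $ j = adjacency E $ j $ i"
  by (auto simp: adjacency_def simple_graph_def dest: sympD)

lemma trace_adjacency: "simple_graph E \<Longrightarrow> trace (adjacency E) = 0"
  by (simp add: trace_def adjacency_def simple_graph_def irreflp_def)

lemma conj_transpose_adjacency: "simple_graph E \<Longrightarrow> conj_transpose (adjacency E) = adjacency E"
  by (auto simp: conj_transpose_def adjacency_def vec_eq_iff simple_graph_def dest: sympD)

lemma conj_transpose_mat_power:
  assumes "simple_graph E"
  shows "conj_transpose (mat_power (adjacency E) k) = mat_power (adjacency E) k"
proof (induction k)
  case 0
  show ?case by (simp add: conj_transpose_def mat_def vec_eq_iff)
next
  case (Suc k)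
  then show ?case by (simp add: conj_transpose_mult conj_transpose_adjacency[OF assms] mat_power_commute)
qed

lemma matrix_star_algebra_adjacency:
  assumes graph: "simple_graph E"
  shows "matrix_star_algebra (adjacency_algebra E)"
proof
  show sub: "cmat.subspace (adjacency_algebra E)"
    unfolding adjacency_algebra_span by (rule cmat.subspace_span)
  show "mat 1 \<in> adjacency_algebra E" using mat_power_in_adjacency_algebra[of E 0] by simp
  have power_mult: "mat_power (adjacency E) k ** Y \<in> adjacency_algebra E"
    if "Y \<in> adjacency_algebra E" for k Y
    using that
  proof (induction rule: adjacency_algebra_induct)
    case (power j)
    then show ?case by (metis mat_power_add mat_power_in_adjacency_algebra)
  qed (simp_all add: matrix_add_ldistrib mat_scale_mult_right cmat.subspace_0 cmat.subspace_add
      cmat.subspace_scale sub matrix_mult_0_right)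
  show "X ** Y \<in> adjacency_algebra E" if "X \<in> adjacency_algebra E" "Y \<in> adjacency_algebra E" for X Y
    using that(1)
  proof (induction rule: adjacency_algebra_induct)
    case (power k)
    show ?case using that(2) by (rule power_mult)
  qed (simp_all add: matrix_add_rdistrib mat_scale_mult_left cmat.subspace_0 cmat.subspace_add
      cmat.subspace_scale sub matrix_mult_0_left)
  show "conj_transpose X \<in> adjacency_algebra E" if "X \<in> adjacency_algebra E" for X
    using that
  proof (induction rule: adjacency_algebra_induct)
    case zero
    have "conj_transpose 0 = (0 :: 'a cmat)" by (simp add: conj_transpose_def vec_eq_iff)
    then show ?case by (simp add: cmat.subspace_0 sub)
  next
    case (power k)
    then show ?case by (simp add: conj_transpose_mat_power[OF graph] mat_power_in_adjacency_algebra)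
  qed (simp_all add: conj_transpose_add conj_transpose_scale cmat.subspace_add
      cmat.subspace_scale sub)
qed

lemma transpose_adjacency_algebra:
  assumes graph: "simple_graph E" and Z: "Z \<in> adjacency_algebra E"
  shows "transpose Z = Z"
  using Z
proof (induction rule: adjacency_algebra_induct)
  case (add X Y)
  then show ?case by (simp add: transpose_def vec_eq_iff)
next
  case (scale c X)
  then show ?case by (simp add: transpose_def vec_eq_iff mat_scale_def)
next
  case (power k)
  show ?case
  proof (induction k)
    case (Suc k)
    have "transpose (adjacency E) = adjacency E"
      by (simp add: transpose_def vec_eq_iff adjacency_entry_commute[OF graph])
    then show ?case using Suc by (simp add: matrix_transpose_mul mat_power_commute)
  qed (simp add: transpose_mat)
qed (simp add: transpose_def vec_eq_iff)

lemma adjacency_algebra_entry_commute: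
  assumes "simple_graph E" "Z \<in> adjacency_algebra E"
  shows "Z $ i $ j = Z $ j $ i"
  using transpose_adjacency_algebra[OF assms] by (metis transpose_def vec_lambda_beta)

section \<open>Walk-regularity and connectedness\<close>

text \<open>
  Walk-regularity states this for the powers of the adjacency matrix, and the property passes
  to linear combinations.
\<close>

lemma one_walk_regular_entries:
  assumes graph: "simple_graph E" "one_walk_regular E" and Z: "Z \<in> adjacency_algebra E"
  shows "\<exists>a b. (\<forall>i. Z $ i $ i = a) \<and> (\<forall>i j. E i j \<longrightarrow> Z $ i $ j = b)"
  using Z
proof (induction rule: adjacency_algebra_induct)
  case (add X Y)
  then obtain a b a' b' where "\<forall>i. X $ i $ i = a" "\<forall>i j. E i j \<longrightarrow> X $ i $ j = b"
    "\<forall>i. Y $ i $ i = a'" "\<forall>i j. E i j \<longrightarrow> Y $ i $ j = b'" by blast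
  then show ?case by (intro exI[of _ "a + a'"] exI[of _ "b + b'"]) simp
next
  case (scale c X)
  then obtain a b where "\<forall>i. X $ i $ i = a" "\<forall>i j. E i j \<longrightarrow> X $ i $ j = b" by blast
  then show ?case by (intro exI[of _ "c * a"] exI[of _ "c * b"]) (simp add: mat_scale_def)
next
  case (power k)
  show ?case
  proof (cases "k = 0")
    case True
    have "\<not> E i i" for i using graph by (simp add: simple_graph_def irreflp_def)
    then have "E i j \<Longrightarrow> i \<noteq> j" for i j by blast
    then show ?thesis using True by (intro exI[of _ 1] exI[of _ 0]) (simp add: mat_def)
  next
    case False
    then have "1 \<le> k" by simp
    then obtain a b where "mat_power (adjacency E) k \<circ>\<^sub>S mat 1 = mat_scale a (mat 1)"
      "mat_power (adjacency E) k \<circ>\<^sub>S adjacency E = mat_scale b (adjacency E)"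
      using graph(2) unfolding one_walk_regular_def by meson
    then have "mat_power (adjacency E) k $ i $ j * mat 1 $ i $ j = a * mat 1 $ i $ j"
      "mat_power (adjacency E) k $ i $ j * adjacency E $ i $ j = b * adjacency E $ i $ j" for i j
      by (simp_all add: schur_def mat_scale_def vec_eq_iff)
    note e = this
    have "mat_power (adjacency E) k $ i $ i = a" for i
      using e(1)[of i i] by (simp add: mat_def)
    moreover have "mat_power (adjacency E) k $ i $ j = b" if "E i j" for i j
      using e(2)[of i j] that by (simp add: adjacency_def)
    ultimately show ?thesis by blast
  qed
qed auto

text \<open>
  The row sums are the vertex degrees, which are the diagonal entries of the square of the
  adjacency matrix.
\<close>

lemma one_walk_regular_row_sums:
  assumes graph: "simple_graph E" "one_walk_regular E"
  obtains k where "adjacency E *v 1 = k *s 1"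
proof -
  obtain a where a: "\<And>i. mat_power (adjacency E) 2 $ i $ i = a"
    using one_walk_regular_entries[OF graph mat_power_in_adjacency_algebra] by blast
  have "(adjacency E *v 1) $ i = a" for i
  proof -
    have "(adjacency E *v 1) $ i = (\<Sum>j\<in>UNIV. adjacency E $ i $ j * adjacency E $ j $ i)"
      by (simp add: matrix_vector_mult_def adjacency_entry_commute[OF graph(1), of _ i])
        (auto simp: adjacency_def intro!: sum.cong)
    also have "\<dots> = mat_power (adjacency E) 2 $ i $ i"
      by (simp add: numeral_2_eq_2 matrix_matrix_mult_def[of "adjacency E" "adjacency E"])
    finally show ?thesis using a by simp
  qed
  then show thesis using that[of a] by (simp add: vec_eq_iff)
qed

lemma adjacency_algebra_ones:
  assumes graph: "simple_graph E" "one_walk_regular E" and Z: "Z \<in> adjacency_algebra E"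
  shows "\<exists>z. Z *v 1 = z *s 1"
proof -
  obtain k where k: "adjacency E *v 1 = k *s 1"
    using one_walk_regular_row_sums[OF graph] .
  show ?thesis using Z
  proof (induction rule: adjacency_algebra_induct)
    case zero
    show ?case by (intro exI[of _ 0]) (simp add: vec_eq_iff matrix_vector_mult_def)
  next
    case (add X Y)
    then obtain x y where "X *v 1 = x *s 1" "Y *v 1 = y *s 1" by blast
    then show ?case
      by (intro exI[of _ "x + y"]) (simp add: matrix_vector_mult_add_rdistrib vector_sadd_rdistrib)
  next
    case (scale c X)
    then obtain x where "X *v 1 = x *s 1" by blast
    moreover have "mat_scale c X *v 1 = c *s (X *v 1)"
      by (simp add: vec_eq_iff matrix_vector_mult_def mat_scale_def sum_distrib_left)
    ultimately show ?case by (intro exI[of _ "c * x"]) simp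
  next
    case (power m)
    show ?case
    proof (induction m)
      case 0
      show ?case by (intro exI[of _ 1]) simp
    next
      case (Suc m)
      then obtain x where "mat_power (adjacency E) m *v 1 = x *s 1" by blast
      then show ?case
        by (intro exI[of _ "x * k"])
          (simp add: matrix_vector_mul_assoc[symmetric] vector_scalar_commute k)
    qed
  qed
qed

text \<open>
  The Laplacian form \<open>\<Sum> \<bar>x\<^sub>i - x\<^sub>j\<bar>\<^sup>2\<close> over the edges vanishes at \<open>x\<close>, so \<open>x\<close> takes the same
  value at the two ends of each edge and hence along each path.
\<close>

lemma connected_eigenvector_const:
  assumes graph: "simple_graph E" "connected_graph E"
    and k: "adjacency E *v 1 = k *s 1" and x: "adjacency E *v x = k *s x"
  shows "x $ i = x $ j"
proof -
  let ?A = "adjacency E"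
  define z where "z i = (\<Sum>j\<in>UNIV. ?A $ i $ j * (x $ i - x $ j))" for i
  have z: "z i = 0" for i
  proof -
    have "z i = (?A *v 1) $ i * x $ i - (?A *v x) $ i"
      by (simp add: z_def matrix_vector_mult_def right_diff_distrib sum_subtractf sum_distrib_right)
    then show ?thesis using k x by simp
  qed
  have "of_real (\<Sum>i\<in>UNIV. \<Sum>j\<in>UNIV. if E i j then (norm (x $ i - x $ j))\<^sup>2 else 0) =
      (\<Sum>i\<in>UNIV. \<Sum>j\<in>UNIV. ?A $ i $ j * ((x $ i - x $ j) * cnj (x $ i - x $ j)))"
    unfolding of_real_sum
    by (intro sum.cong refl) (simp only: adjacency_def vec_lambda_beta if_distrib complex_norm_square of_real_0 split: if_split, simp)
  also have "\<dots> = (\<Sum>i\<in>UNIV. \<Sum>j\<in>UNIV. ?A $ i $ j * (x $ i - x $ j) * cnj (x $ i))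
      + (\<Sum>i\<in>UNIV. \<Sum>j\<in>UNIV. ?A $ i $ j * (x $ j - x $ i) * cnj (x $ j))"
    by (simp add: sum.distrib[symmetric] algebra_simps)
  also have "(\<Sum>i\<in>UNIV. \<Sum>j\<in>UNIV. ?A $ i $ j * (x $ j - x $ i) * cnj (x $ j)) =
      (\<Sum>j\<in>UNIV. z j * cnj (x $ j))"
    unfolding z_def sum_distrib_right
    by (subst sum.swap) (simp add: adjacency_entry_commute[OF graph(1)])
  also have "(\<Sum>i\<in>UNIV. \<Sum>j\<in>UNIV. ?A $ i $ j * (x $ i - x $ j) * cnj (x $ i)) =
      (\<Sum>i\<in>UNIV. z i * cnj (x $ i))"
    by (simp add: z_def sum_distrib_right)
  finally have "of_real (\<Sum>i\<in>UNIV. \<Sum>j\<in>UNIV. if E i j then (norm (x $ i - x $ j))\<^sup>2 else 0) = (0 :: complex)"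
    by (simp add: z)
  then have "(\<Sum>i\<in>UNIV. \<Sum>j\<in>UNIV. if E i j then (norm (x $ i - x $ j))\<^sup>2 else 0) = 0"
    by (simp only: of_real_eq_0_iff)
  then have "\<forall>i\<in>UNIV. (\<Sum>j\<in>UNIV. if E i j then (norm (x $ i - x $ j))\<^sup>2 else 0) = 0"
    by (subst (asm) sum_nonneg_eq_0_iff) (auto intro!: sum_nonneg)
  then have "\<forall>i. \<forall>j\<in>UNIV. (if E i j then (norm (x $ i - x $ j))\<^sup>2 else 0) = 0"
    by (subst (asm) sum_nonneg_eq_0_iff) auto
  then have step: "x $ i = x $ j" if "E i j" for i j using that
    by (metis UNIV_I eq_iff_diff_eq_0 norm_eq_zero power_eq_0_iff)
  have "E\<^sup>*\<^sup>* i j" using graph(2) by (simp add: connected_graph_def)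
  then show ?thesis by (induction rule: rtranclp_induct) (auto dest: step)
qed

text \<open>
  The matrix \<open>A - k I\<close> annihilates the all-ones vector and hence some \<open>Z \<noteq> 0\<close> in the algebra.
  The columns of \<open>Z\<close> are eigenvectors of \<open>A\<close> for \<open>k\<close>, thus constant; as \<open>Z\<close> is symmetric, all
  its entries agree.
\<close>

lemma all_ones_in_adjacency_algebra:
  assumes graph: "simple_graph E" "one_walk_regular E" "connected_graph E"
  shows "all_ones \<in> adjacency_algebra E"
proof -
  interpret matrix_star_algebra "adjacency_algebra E"
    by (rule matrix_star_algebra_adjacency[OF graph(1)])
  obtain k where k: "adjacency E *v 1 = k *s 1"
    using one_walk_regular_row_sums[OF graph(1,2)] .
  define T where "T = adjacency E - mat_scale k (mat 1)"
  have T: "T *v x = adjacency E *v x - k *s x" for x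
    by (simp add: T_def shifted_matrix_mult_vec)
  have "T \<in> adjacency_algebra E"
    unfolding T_def by (intro cmat.subspace_diff cmat.subspace_scale subspace adjacency_in_adjacency_algebra one_closed)
  moreover have "T *v 1 = 0" using k by (simp add: T)
  ultimately obtain Z where Z: "Z \<in> adjacency_algebra E" "Z \<noteq> 0" "T ** Z = 0"
    using singular_imp_right_zero_divisor[of T 1] by (metis one_neq_zero)
  have col: "Z $ i $ j = Z $ i' $ j" for i i' j
  proof -
    have "T *v (Z *v axis j 1) = 0" using Z(3)
      by (simp add: matrix_vector_mul_assoc)
    then have "adjacency E *v (Z *v axis j 1) = k *s (Z *v axis j 1)" by (simp add: T)
    from connected_eigenvector_const[OF graph(1,3) k this, of i i'] show ?thesis
      by (simp add: matrix_vector_mult_axis)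
  qed
  obtain i0 j0 where nz: "Z $ i0 $ j0 \<noteq> 0" using Z(2) by (auto simp: vec_eq_iff)
  have "Z $ i $ j = Z $ i0 $ j0" for i j
    by (metis col adjacency_algebra_entry_commute[OF graph(1) Z(1)])
  then obtain z where "z \<noteq> 0" "\<And>i j. Z $ i $ j = z" using nz by blast
  then have eq: "all_ones = mat_scale (inverse z) Z"
    by (simp add: all_ones_def mat_scale_def vec_eq_iff)
  show ?thesis unfolding eq by (rule cmat.subspace_scale[OF subspace Z(1)])
qed

section \<open>Matrices supported on the diagonal and the edges\<close>

lemma schur_complement_eq_0D:
  assumes "N \<circ>\<^sub>S complement_adjacency E = 0" "i \<noteq> j" "\<not> E i j"
  shows "N $ i $ j = 0"
proof -
  have "N $ i $ j * complement_adjacency E $ i $ j = 0"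
    using assms(1) by (simp add: schur_def vec_eq_iff)
  then show ?thesis using assms(2,3)
    by (simp add: complement_adjacency_def all_ones_def adjacency_def mat_def)
qed

text \<open>
  The inner product sees only the entries of \<open>Z\<close> on the diagonal and the edges.
\<close>

lemma mat_inner_supported_const:
  assumes graph: "simple_graph E"
    and supp: "X \<circ>\<^sub>S complement_adjacency E = 0"
    and Z: "\<And>i. Z $ i $ i = a" "\<And>i j. E i j \<Longrightarrow> Z $ i $ j = b"
  shows "mat_inner X Z = cnj a * trace X + cnj b * mat_inner X (adjacency E)"
proof -
  have "X $ i $ j * cnj (Z $ i $ j) = cnj a * (X $ i $ j * cnj (mat 1 $ i $ j))
      + cnj b * (X $ i $ j * cnj (adjacency E $ i $ j))" for i j
    using Z schur_complement_eq_0D[OF supp] graph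
    by (cases "i = j"; cases "E i j") (auto simp: mat_def adjacency_def simple_graph_def irreflp_def)
  then show ?thesis
    unfolding mat_inner_one[symmetric] mat_inner_entries
    by (simp add: sum_distrib_left sum.distrib)
qed

text \<open>
  The right-hand side \<open>Y\<close> has the same trace, the same inner product with \<open>A\<close> and the same
  support as \<open>N\<close>, so the two matrices have equal inner products with every matrix that is constant
  on the diagonal and on the edges.  The elements of the algebra are of this kind, and so is \<open>J\<close>,
  whether or not it lies in the algebra.
\<close>

lemma orth_proj_supported:
  fixes N :: "'n::finite cmat"
  assumes graph: "simple_graph E" "one_walk_regular E" and ne: "adjacency E \<noteq> 0"
    and supp: "N \<circ>\<^sub>S complement_adjacency E = 0"
  defines "Y \<equiv> mat_scale (trace N / of_nat CARD('n)) (mat 1)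
      + mat_scale (mat_inner N (adjacency E) / mat_inner (adjacency E) (adjacency E)) (adjacency E)"
  shows "orth_proj (adjacency_algebra E) N = Y"
    and "trace (all_ones ** Y) = trace (all_ones ** N)"
proof -
  interpret matrix_star_algebra "adjacency_algebra E"
    by (rule matrix_star_algebra_adjacency[OF graph(1)])
  have AA: "mat_inner (adjacency E) (adjacency E) \<noteq> 0" using ne by (simp add: mat_inner_self)
  have IA: "mat_inner (mat 1) (adjacency E) = 0"
    using mat_inner_commute[of "mat 1" "adjacency E"] trace_adjacency[OF graph(1)]
    by (simp add: mat_inner_one)
  have trY: "trace Y = trace N"
    by (simp add: Y_def trace_add trace_scale trace_one trace_adjacency[OF graph(1)])
  have YA: "mat_inner Y (adjacency E) = mat_inner N (adjacency E)"
    using AA by (simp add: Y_def mat_inner_add_left mat_inner_scale_left IA)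
  have suppY: "Y \<circ>\<^sub>S complement_adjacency E = 0"
    using graph(1)
    by (auto simp: Y_def schur_def complement_adjacency_def all_ones_def mat_scale_def mat_def
        adjacency_def vec_eq_iff simple_graph_def irreflp_def)
  have same: "mat_inner Y Z = mat_inner N Z"
    if "\<And>i. Z $ i $ i = a" "\<And>i j. E i j \<Longrightarrow> Z $ i $ j = b" for Z a b
    using mat_inner_supported_const[OF graph(1) supp that] mat_inner_supported_const[OF graph(1) suppY that]
    by (simp add: trY YA)
  show "trace (all_ones ** Y) = trace (all_ones ** N)"
    unfolding trace_all_ones_mult by (rule same[of _ 1 1]) (simp_all add: all_ones_def)
  show "orth_proj (adjacency_algebra E) N = Y"
  proof (rule orth_proj_eqI[OF subspace])
    show "Y \<in> adjacency_algebra E"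
      unfolding Y_def
      by (intro cmat.subspace_add cmat.subspace_scale subspace one_closed adjacency_in_adjacency_algebra)
    fix Z assume "Z \<in> adjacency_algebra E"
    then obtain a b where "\<And>i. Z $ i $ i = a" "\<And>i j. E i j \<Longrightarrow> Z $ i $ j = b"
      using one_walk_regular_entries[OF graph] by meson
    then show "mat_inner (N - Y) Z = 0" using same[of Z a b] by (simp add: mat_inner_diff_left)
  qed
qed

text \<open>
  For \<open>r \<ge> 2\<close> the factor \<open>\<langle>A\<^sub>r, N\<rangle>\<close> is zero because \<open>N'\<close> is a combination of \<open>I\<close> and \<open>A\<close>.
\<close>

lemma orthogonal_basis_products:
  fixes N :: "'n::finite cmat"
  assumes graph: "simple_graph E" "one_walk_regular E" and ne: "adjacency E \<noteq> 0"
    and supp: "N \<circ>\<^sub>S complement_adjacency E = 0"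
    and basis: "orthogonal_basis (adjacency_algebra E) B d"
      "1 \<le> d" "B 0 = mat 1" "B 1 = adjacency E"
  shows "(\<forall>r\<in>{1..d}. mat_inner M (B r) * mat_inner (B r) N = 0) \<longleftrightarrow>
    mat_inner M (adjacency E) * mat_inner (adjacency E) N = 0"
proof -
  interpret matrix_star_algebra "adjacency_algebra E"
    by (rule matrix_star_algebra_adjacency[OF graph(1)])
  have "mat_inner (B r) N = 0" if r: "r \<in> {1..d}" "r \<noteq> 1" for r
  proof -
    have orth: "mat_inner (mat 1) (B r) = 0" "mat_inner (adjacency E) (B r) = 0"
      using r basis unfolding orthogonal_basis_def
      by (metis atLeastAtMost_iff not_one_le_zero zero_le, metis atLeastAtMost_iff)
    have "B r \<in> adjacency_algebra E"
      using basis(1) r(1) unfolding orthogonal_basis_def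
      by (metis atLeastAtMost_iff atMost_iff cmat.span_base imageI)
    then have "mat_inner N (B r) = mat_inner (orth_proj (adjacency_algebra E) N) (B r)"
      by (simp add: orth_proj(2)[OF subspace])
    also have "\<dots> = 0"
      by (simp add: orth_proj_supported(1)[OF graph ne supp] mat_inner_add_left mat_inner_scale_left orth)
    finally show ?thesis by (simp add: mat_inner_commute[of "B r" N])
  qed
  then show ?thesis using basis(2,4) by (metis atLeastAtMost_iff mult_zero_right order_refl)
qed

lemma mat_inner_schur_adjacency:
  "mat_inner X (adjacency E) = (\<Sum>i\<in>UNIV. \<Sum>j\<in>UNIV. (X \<circ>\<^sub>S adjacency E) $ i $ j)"
  unfolding mat_inner_entries schur_def by (intro sum.cong refl) (simp add: adjacency_def)

lemma conditions_inner_nonpos: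
  assumes "condition_A E M N \<or> condition_B E M N"
  shows "mat_inner M (adjacency E) * mat_inner (adjacency E) N \<le> 0"
  using assms
proof
  assume "condition_A E M N"
  then show ?thesis by (simp add: condition_A_def mat_inner_schur_adjacency)
next
  assume B: "condition_B E M N"
  have "mat_inner M (adjacency E) \<le> 0"
    unfolding mat_inner_schur_adjacency
    by (intro sum_nonpos) (use B in \<open>simp add: condition_B_def less_eq_vec_def\<close>)
  moreover have "0 \<le> mat_inner N (adjacency E)"
    unfolding mat_inner_schur_adjacency
    by (intro sum_nonneg) (use B in \<open>simp add: condition_B_def less_eq_vec_def\<close>)
  then have "0 \<le> mat_inner (adjacency E) N"
    unfolding mat_inner_commute[of "adjacency E" N] by (simp add: less_eq_complex_def)
  ultimately show ?thesis by (rule mult_nonpos_nonneg)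
qed

section \<open>The slack in the bound\<close>

text \<open>
  The projection of \<open>N\<close> with its component along the all-ones vector removed.  Its inner product
  with \<open>M\<close> is one of the two contributions to the gap between the sides of the bound.
\<close>

definition slack_matrix :: "('n::finite \<Rightarrow> 'n \<Rightarrow> bool) \<Rightarrow> 'n cmat \<Rightarrow> 'n cmat"
  where "slack_matrix E N = orth_proj (adjacency_algebra E) N
      - mat_scale (trace (all_ones ** N) / (of_nat CARD('n))\<^sup>2) all_ones"

text \<open>
  The slack matrix is the deflation of the projection along the all-ones vector, which is an
  eigenvector of every element of the algebra.
\<close>

lemma psd_slack_matrix:
  fixes N :: "'n::finite cmat"
  assumes graph: "simple_graph E" "one_walk_regular E" and ne: "adjacency E \<noteq> 0"
    and N: "psd N" and supp: "N \<circ>\<^sub>S complement_adjacency E = 0"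
  shows "psd (slack_matrix E N)"
proof -
  interpret matrix_star_algebra "adjacency_algebra E"
    by (rule matrix_star_algebra_adjacency[OF graph(1)])
  let ?Y = "orth_proj (adjacency_algebra E) N"
  have psdY: "psd ?Y" using N by (rule psd_orth_proj)
  obtain t where t: "?Y *v 1 = t *s 1"
    using adjacency_algebra_ones[OF graph orth_proj(1)[OF subspace]] by blast
  have form: "herm_form ?Y 1 1 = t * of_nat CARD('n)"
    by (simp add: herm_form_def t)
  \<comment> \<open>Deflation subtracts \<open>t (cnj t) / (t n)\<close> times \<open>J\<close>; since \<open>t\<close> is real, this factor is \<open>t / n\<close>.\<close>
  have "cnj (herm_form ?Y 1 1) = herm_form ?Y 1 1"
    using psdY herm_form_conj[of ?Y 1 1] by (simp add: psd_def)
  then have "cnj t = t" by (simp add: form)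
  moreover have "trace (all_ones ** N) = t * of_nat CARD('n)"
    using orth_proj_supported[OF graph ne supp] form
    by (simp add: trace_all_ones_mult_form)
  ultimately have "deflate ?Y 1 = slack_matrix E N"
    by (simp add: slack_matrix_def deflate_def form t)
      (simp add: vec_eq_iff mat_scale_def all_ones_def field_simps power2_eq_square)
  then show ?thesis using psd_deflate[OF psdY, of 1] by simp
qed

text \<open>
  Two evaluations of \<open>tr (M N')\<close>, from the basis \<open>I\<close>, \<open>A\<close> and from the slack matrix.
\<close>

lemma trace_slack_identity:
  fixes M N :: "'n::finite cmat"
  assumes graph: "simple_graph E" "one_walk_regular E" and ne: "adjacency E \<noteq> 0"
    and N: "psd N" and supp: "N \<circ>\<^sub>S complement_adjacency E = 0"
  shows "trace (all_ones ** M) * trace (all_ones ** N) =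
      of_nat CARD('n) * trace M * trace N
      - (of_nat CARD('n))\<^sup>2 * (trace (M ** slack_matrix E N)
        - mat_inner M (adjacency E) * mat_inner (adjacency E) N / mat_inner (adjacency E) (adjacency E))"
proof -
  let ?A = "adjacency E" and ?n = "of_nat CARD('n) :: complex"
  have hN: "conj_transpose N = N" using N by (simp add: psd_def)
  have NA: "mat_inner N ?A = mat_inner ?A N"
    unfolding mat_inner_hermitian[OF hN] mat_inner_hermitian[OF conj_transpose_adjacency[OF graph(1)]]
    by (rule trace_mul_sym)
  have MA: "trace (M ** ?A) = mat_inner M ?A"
    by (rule mat_inner_hermitian[symmetric]) (rule conj_transpose_adjacency[OF graph(1)])
  have MJ: "trace (M ** all_ones) = trace (all_ones ** M)" by (rule trace_mul_sym)
  have tr: "trace (M ** slack_matrix E N) = trace M * trace N / ?n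
      + mat_inner M ?A * mat_inner ?A N / mat_inner ?A ?A
      - trace (all_ones ** M) * trace (all_ones ** N) / ?n\<^sup>2"
    unfolding slack_matrix_def orth_proj_supported(1)[OF graph ne supp] matrix_diff_ldistrib
      matrix_add_ldistrib mat_scale_mult_right trace_sub trace_add trace_scale matrix_mul_rid MA MJ NA
    by (simp add: mult.commute)
  show ?thesis unfolding tr by (simp add: right_diff_distrib distrib_left power2_eq_square)
qed

text \<open>
  If \<open>tr (M T) = 0\<close> for the slack matrix \<open>T\<close>, then \<open>M T = 0\<close>, and projecting this equation
  leaves \<open>M' T = 0\<close>.  In the other direction \<open>M' T\<close> is a multiple of \<open>J\<close>, and since \<open>T J = 0\<close> the
  factor is \<open>0\<close>; moreover \<open>tr (M T) = tr (M' T)\<close> because \<open>T\<close> lies in the algebra.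
\<close>

lemma trace_mult_slack_eq_0_iff:
  fixes M N :: "'n::finite cmat"
  assumes graph: "simple_graph E" "one_walk_regular E" "connected_graph E" and ne: "adjacency E \<noteq> 0"
    and M: "psd M" and N: "psd N" and supp: "N \<circ>\<^sub>S complement_adjacency E = 0"
  shows "trace (M ** slack_matrix E N) = 0 \<longleftrightarrow>
    (\<exists>c. orth_proj (adjacency_algebra E) M ** orth_proj (adjacency_algebra E) N = mat_scale c all_ones)"
    (is "?L \<longleftrightarrow> (\<exists>c. ?M ** ?N = _)")
proof -
  interpret matrix_star_algebra "adjacency_algebra E"
    by (rule matrix_star_algebra_adjacency[OF graph(1)])
  note proj = orth_proj[OF subspace]
  let ?T = "slack_matrix E N" and ?J = "all_ones :: 'n cmat" and ?n = "of_nat CARD('n) :: complex"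
  define s where "s = trace (?J ** N) / ?n\<^sup>2"
  have J: "?J \<in> adjacency_algebra E" using graph by (rule all_ones_in_adjacency_algebra)
  have T: "?T \<in> adjacency_algebra E" "?N = ?T + mat_scale s ?J"
    unfolding slack_matrix_def s_def
    by (intro cmat.subspace_diff cmat.subspace_scale subspace J proj) simp
  have psdT: "psd ?T" by (rule psd_slack_matrix[OF graph(1,2) ne N supp])
  have mult_J: "\<exists>x. X ** ?J = mat_scale x ?J \<and> X *v 1 = x *s 1" if X: "X \<in> adjacency_algebra E" for X
  proof -
    obtain x where x: "X *v 1 = x *s 1" using adjacency_algebra_ones[OF graph(1,2) X] by blast
    then have "(X *v 1) $ i = x" for i by simp
    then have "X ** ?J = mat_scale x ?J"
      by (simp add: vec_eq_iff matrix_matrix_mult_def matrix_vector_mult_def mat_scale_def all_ones_def)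
    then show ?thesis using x by blast
  qed
  have trMT: "trace (M ** ?T) = trace (?M ** ?T)"
    using proj(2)[OF T(1), of M] psdT by (simp add: mat_inner_hermitian psd_def)
  show ?thesis
  proof
    assume ?L
    then have "M ** ?T = 0" by (rule trace_psd_mult(2)[OF M psdT])
    then have "?M ** ?T = orth_proj (adjacency_algebra E) 0"
      using orth_proj_mult_right[OF T(1), of M] by simp
    also have "\<dots> = 0"
      by (rule orth_proj_eqI) (simp_all add: subspace cmat.subspace_0 mat_inner_entries)
    finally have "?M ** ?N = mat_scale s (?M ** ?J)"
      by (simp add: T(2) matrix_add_ldistrib mat_scale_mult_right)
    also obtain x where "?M ** ?J = mat_scale x ?J" using mult_J[OF proj(1)] by blast
    finally show "\<exists>c. ?M ** ?N = mat_scale c ?J" by (simp only: cmat.scale_scale) blast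
  next
    assume "\<exists>c. ?M ** ?N = mat_scale c ?J"
    then obtain c where c: "?M ** ?N = mat_scale c ?J" by blast
    obtain t where t: "?T ** ?J = mat_scale t ?J" "?T *v 1 = t *s 1"
      using mult_J[OF T(1)] by blast
    have J2: "?J ** ?J = mat_scale ?n ?J"
      by (simp add: vec_eq_iff matrix_matrix_mult_def mat_scale_def all_ones_def)
    obtain x where x: "?M ** ?J = mat_scale x ?J" using mult_J[OF proj(1)] by blast
    \<comment> \<open>The all-ones vector has been removed from \<open>T\<close>: its eigenvalue \<open>t\<close> is zero.\<close>
    have "t * ?n = herm_form ?T 1 1" by (simp add: herm_form_def t(2))
    also have "\<dots> = trace (?J ** ?N) - s * ?n\<^sup>2"
      unfolding trace_all_ones_mult_form[symmetric]
      by (simp add: T(2) matrix_add_ldistrib mat_scale_mult_right trace_add trace_scale J2 power2_eq_square)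
         (simp add: trace_def all_ones_def)
    also have "trace (?J ** ?N) = trace (?J ** N)"
      unfolding trace_all_ones_mult by (rule proj(2)[OF J])
    finally have "t = 0" by (simp add: s_def)
    then have TJ: "?T ** ?J = 0" using t by (simp add: mat_scale_def vec_eq_iff)
    have MT: "?M ** ?T = mat_scale (c - s * x) ?J"
      using c by (simp add: T(2) matrix_add_ldistrib mat_scale_mult_right x)
        (simp add: cmat.scale_left_diff_distrib eq_diff_eq)
    have "?M ** (?T ** ?J) = mat_scale ((c - s * x) * ?n) ?J"
      unfolding matrix_mul_assoc MT mat_scale_mult_left J2 by simp
    then have "(c - s * x) * ?n = 0"
      unfolding TJ by (simp add: matrix_mult_0_right vec_eq_iff mat_scale_def all_ones_def)
    then have "c - s * x = 0" by simp
    then have "?M ** ?T = 0" using MT by simp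
    then show ?L unfolding trMT by (simp add: trace_def)
  qed
qed

theorem theorem8:
  fixes E :: "'n::finite \<Rightarrow> 'n \<Rightarrow> bool"
    and B :: "nat \<Rightarrow> 'n cmat" and d :: nat
    and M N :: "'n cmat"
  assumes graph: "simple_graph E" "one_walk_regular E"
    and basis: "orthogonal_basis (adjacency_algebra E) B d"
      "1 \<le> d" "B 0 = mat 1" "B 1 = adjacency E"
    and M: "psd M" "M \<noteq> 0"
    and N: "psd N" "N \<noteq> 0"
    and cond: "condition_A E M N \<or> condition_B E M N"
  shows "of_nat CARD('n) \<ge>
           (trace (all_ones ** M) * trace (all_ones ** N)) / (trace M * trace N)
       \<and> (connected_graph E \<longrightarrow>
           (of_nat CARD('n) =
              (trace (all_ones ** M) * trace (all_ones ** N)) / (trace M * trace N)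
            \<longleftrightarrow>
            (\<exists>c. orth_proj (adjacency_algebra E) M ** orth_proj (adjacency_algebra E) N
                  = mat_scale c all_ones) \<and>
            (condition_A E M N \<or>
             condition_B E M N \<and>
               (\<forall>r\<in>{1..d}. mat_inner M (B r) * mat_inner (B r) N = 0))))"
proof -
  let ?A = "adjacency E" and ?n = "real CARD('n)"
  have supp: "N \<circ>\<^sub>S complement_adjacency E = 0"
    using cond by (auto simp: condition_A_def condition_B_def)
  have ne: "?A \<noteq> 0"
    using basis unfolding orthogonal_basis_def by (metis atMost_iff cmat.dependent_zero imageI)
  define s where "s = Re (trace (M ** slack_matrix E N))"
  define q where "q = Re (mat_inner M ?A * mat_inner ?A N)"
  define w where "w = (norm ?A)\<^sup>2"
  have s: "trace (M ** slack_matrix E N) = of_real s" "0 \<le> s"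
    using trace_psd_mult(1)[OF M(1) psd_slack_matrix[OF graph ne N(1) supp]]
    by (auto simp: s_def less_eq_complex_def complex_eq_iff)
  have q: "mat_inner M ?A * mat_inner ?A N = of_real q" "q \<le> 0"
    using conditions_inner_nonpos[OF cond] by (auto simp: q_def less_eq_complex_def complex_eq_iff)
  have w: "mat_inner ?A ?A = of_real w" "0 < w"
    using ne by (simp_all add: w_def mat_inner_self)
  have tM: "trace M = of_real (Re (trace M))" "0 < Re (trace M)"
    using psd_trace_pos[OF M] by (auto simp: less_complex_def complex_eq_iff)
  have tN: "trace N = of_real (Re (trace N))" "0 < Re (trace N)"
    using psd_trace_pos[OF N] by (auto simp: less_complex_def complex_eq_iff)
  \<comment> \<open>The amount by which the bound exceeds the quotient of traces.\<close>
  define gap where "gap = ?n\<^sup>2 * (s - q / w) / (Re (trace M) * Re (trace N))"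
  have nonzero: "trace M * trace N \<noteq> 0" using tM tN by auto
  have gap: "(trace (all_ones ** M) * trace (all_ones ** N)) / (trace M * trace N) = of_nat CARD('n) - of_real gap"
  proof -
    have "of_real gap = (of_nat CARD('n))\<^sup>2 * (of_real s - of_real q / of_real w) / (trace M * trace N)"
      unfolding gap_def by (subst tM(1), subst tN(1)) simp
    then show ?thesis
      unfolding trace_slack_identity[OF graph ne N(1) supp] s(1) q(1) w(1)
      using nonzero by (simp add: diff_divide_distrib)
  qed
  have nonneg: "0 \<le> - q / w" using q w by (simp add: divide_nonpos_pos)
  have "0 \<le> gap" unfolding gap_def using s nonneg tM(2) tN(2) by (intro divide_nonneg_pos mult_nonneg_nonneg) auto
  moreover have "gap = 0 \<longleftrightarrow> s = 0 \<and> q = 0"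
  proof -
    have "gap = 0 \<longleftrightarrow> s - q / w = 0" using tM(2) tN(2) by (simp add: gap_def)
    also have "\<dots> \<longleftrightarrow> s = 0 \<and> q / w = 0" using s(2) nonneg by auto
    finally show ?thesis using w(2) by simp
  qed
  moreover have "s = 0 \<longleftrightarrow> (\<exists>c. orth_proj (adjacency_algebra E) M ** orth_proj (adjacency_algebra E) N
                  = mat_scale c all_ones)" if "connected_graph E"
    using trace_mult_slack_eq_0_iff[OF graph that ne M(1) N(1) supp] s(1) by simp
  moreover have "q = 0 \<longleftrightarrow> condition_A E M N \<or>
             condition_B E M N \<and> (\<forall>r\<in>{1..d}. mat_inner M (B r) * mat_inner (B r) N = 0)"
  proof -
    have "q = 0" if "condition_A E M N"
      using that by (simp add: q_def condition_A_def mat_inner_schur_adjacency)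
    then show ?thesis
      unfolding orthogonal_basis_products[OF graph ne supp basis] q(1) using cond by auto
  qed
  ultimately show ?thesis
    unfolding gap by (auto simp: less_eq_complex_def)
qed

end
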